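(* Let $m\geqslant 2$, let $\mu\subseteq\lambda$ be partitions and $1\leqslant k<m$. For every $T\in\mathsf{SVT}^m(\lambda/\mu)$ we have $\mathsf{res}(f_k(T))=f^\star_k(\mathsf{res}(T))$ and $\mathsf{res}(e_k(T))=e^\star_k(\mathsf{res}(T))$, with the convention $\mathsf{res}(0)=0$ (so in particular $f_k(T)=0$ if and only if $f^\star_k(\mathsf{res}(T))=0$, and similarly for $e_k$).
   Context: Tableaux are in French notation; cell $(i,j)$ lies in row $i$ (from the bottom) and column $j$. $\mathsf{SVT}^m(\lambda/\mu)$ is the set of fillings of the cells of $\lambda/\mu$ by nonempty subsets of $[m]$ with $\max(A)\leqslant\min(B)$ for horizontally adjacent cells $A$ left of $B$ and $\max(A)<\min(C)$ for vertically adjacent cells $A$ below $C$. Crystal on $\mathsf{SVT}^m(\lambda/\mu)$: assign $-$ to each column containing $k$ but not $k+1$, and $+$ to each column containing $k+1$ but not $k$; successively pair each $+$ with an adjacent $-$ to its right (ignoring paired signs) until no more pairs form. If no unpaired $-$ exists, $f_k(T)=0$; else let $b$ be the cell with the $k$ in the rightmost column carrying an unpaired $-$; if the cell $b^\rightarrow$ right of $b$ contains both $k$ and $k+1$, remove $k$ from $b^\rightarrow$ and add $k+1$ to $b$, otherwise change that $k$ in $b$ into $k+1$. If no unpaired $+$ exists, $e_k(T)=0$; else let $b$ be the cell with the $k+1$ in the leftmost column carrying an unpaired $+$; if the cell $b^\leftarrow$ left of $b$ contains both $k$ and $k+1$, remove $k+1$ from $b^\leftarrow$ and add $k$ to $b$,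 otherwise change that $k+1$ into $k$. Residue map: the content of cell $(i,j)$ of $\lambda/\mu$ is $\ell(\lambda)+j-i$ ($\ell(\lambda)$ = number of parts); $\mathsf{res}(T)=h^m\cdots h^1$ where $h^a$ is the decreasing list of contents of the cells containing $a$. Its image lies in $\mathcal{H}^{m,\star}$: the set of decreasing factorizations $h^m\cdots h^1$ (each $h^a$ a possibly empty strictly decreasing word of positive integers) whose product is fully-commutative in the 0-Hecke monoid (words modulo $pq=qp$ for $|p-q|>1$, $pqp=qpq$, $pp=p$; fully-commutative means no equivalent reduced word contains $i(i+1)i$ or $i(i-1)i$ consecutively). $\star$-crystal on $\mathcal{H}^{m,\star}$: pair letters $b$ of $h^{k+1}$, in decreasing order, each with the smallest not-yet-paired letter $a\geqslant b$ of $h^k$ if one exists. If all letters of $h^k$ are paired, $f^\star_k=0$; else with $x$ the largest unpaired letter of $h^k$: if $x+1\in h^k\cap h^{k+1}$, remove $x+1$ from $h^k$ and add $x$ to $h^{k+1}$; otherwise move $x$ from $h^k$ to $h^{k+1}$. If all letters of $h^{k+1}$ are paired, $e^\star_k=0$; else with $y$ the smallest unpaired letter of $h^{k+1}$: if $y-1\in h^k\cap h^{k+1}$, remove $y-1$ from $h^{k+1}$ and add $y$ to $h^k$; otherwise move $y$ from $h^{k+1}$ to $h^k$. *)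

theory Defs
  imports Main
begin

definition is_partition :: "nat list \<Rightarrow> bool" where
  "is_partition lam \<longleftrightarrow> sorted_wrt (\<ge>) lam \<and> 0 \<notin> set lam"

definition part :: "nat list \<Rightarrow> nat \<Rightarrow> nat" where
  "part lam i = (if 1 \<le> i \<and> i \<le> length lam then lam ! (i - 1) else 0)"

definition partition_le :: "nat list \<Rightarrow> nat list \<Rightarrow> bool" where
  "partition_le mu lam \<longleftrightarrow> (\<forall>i. part mu i \<le> part lam i)"

definition skew_cells :: "nat list \<Rightarrow> nat list \<Rightarrow> (nat \<times> nat) set" where
  "skew_cells lam mu = {(i, j). 1 \<le> i \<and> part mu i < j \<and> j \<le> part lam i}"

text \<open>
  A filling is a function on all pairs (row, column), rows counted from the bottom (French
  notation); it takes the value \<open>{}\<close> outside the shape, so that the neighbouring cells inspected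
  by the crystal operators contain nothing when they lie outside the shape.
\<close>

type_synonym filling = "nat \<times> nat \<Rightarrow> nat set"

definition SVT :: "nat \<Rightarrow> nat list \<Rightarrow> nat list \<Rightarrow> filling set" where
  "SVT m lam mu = {T.
     (\<forall>c \<in> skew_cells lam mu. T c \<noteq> {} \<and> T c \<subseteq> {1..m}) \<and>
     (\<forall>c. c \<notin> skew_cells lam mu \<longrightarrow> T c = {}) \<and>
     (\<forall>i j. (i, j) \<in> skew_cells lam mu \<and> (i, j + 1) \<in> skew_cells lam mu
        \<longrightarrow> Max (T (i, j)) \<le> Min (T (i, j + 1))) \<and>
     (\<forall>i j. (i, j) \<in> skew_cells lam mu \<and> (i + 1, j) \<in> skew_cells lam mu
        \<longrightarrow> Max (T (i, j)) < Min (T (i + 1, j)))}"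


subsection \<open>Crystal operators on set-valued tableaux\<close>

datatype sign = Plus | Minus

definition in_column :: "filling \<Rightarrow> nat \<Rightarrow> nat \<Rightarrow> bool" where
  "in_column T j a \<longleftrightarrow> (\<exists>i. a \<in> T (i, j))"

definition column_sign :: "filling \<Rightarrow> nat \<Rightarrow> nat \<Rightarrow> (sign \<times> nat) option" where
  "column_sign T k j =
     (if in_column T j k \<and> \<not> in_column T j (k + 1) then Some (Minus, j)
      else if in_column T j (k + 1) \<and> \<not> in_column T j k then Some (Plus, j)
      else None)"

definition signature :: "nat list \<Rightarrow> nat \<Rightarrow> filling \<Rightarrow> (sign \<times> nat) list" where
  "signature lam k T = List.map_filter (column_sign T k) [1..<part lam 1 + 1]"

inductive pair_step :: "(sign \<times> nat) list \<Rightarrow> (sign \<times> nat) list \<Rightarrow> bool" where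
  "pair_step (u @ (Plus, c) # (Minus, d) # v) (u @ v)"

text \<open>
  The signs left over after successively pairing each \<open>+\<close> with an adjacent \<open>-\<close> to its right.
  By lemma \<open>unpaired_iff\<close> below this is the unique outcome of carrying out
  \<open>pair_step\<close>s, in any order, until none is possible.
\<close>

fun unpaired :: "(sign \<times> nat) list \<Rightarrow> (sign \<times> nat) list" where
  "unpaired [] = []"
| "unpaired (x # w) =
     (case unpaired w of
        [] \<Rightarrow> [x]
      | y # v \<Rightarrow> if fst x = Plus \<and> fst y = Minus then v else x # y # v)"

lemma pair_step_Cons: "pair_step w w' \<Longrightarrow> pair_step (x # w) (x # w')"
  by (induction rule: pair_step.induct) (metis append_Cons pair_step.intros)

lemma pair_steps_Cons: "pair_step\<^sup>*\<^sup>* w w' \<Longrightarrow> pair_step\<^sup>*\<^sup>* (x # w) (x # w')"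
  by (induction rule: rtranclp_induct) (auto intro: pair_step_Cons rtranclp.rtrancl_into_rtrancl)

lemma unpaired_reachable: "pair_step\<^sup>*\<^sup>* w (unpaired w)"
proof (induction w)
  case Nil
  then show ?case by simp
next
  case (Cons x w)
  note steps = pair_steps_Cons[OF Cons, of x]
  show ?case
  proof (cases "unpaired w")
    case Nil
    then show ?thesis using steps by simp
  next
    case (Cons y v)
    have "pair_step (x # y # v) v" if "fst x = Plus" "fst y = Minus"
      using pair_step.intros[of "[]" "snd x" "snd y" v] that by (cases x; cases y) simp
    then show ?thesis
      using steps Cons by (auto intro: rtranclp.rtrancl_into_rtrancl)
  qed
qed

lemma unpaired_no_step: "\<not> pair_step (unpaired w) w'"
proof (induction w arbitrary: w')
  case Nil
  then show ?case by (auto elim: pair_step.cases)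
next
  case (Cons x w)
  have tail: "\<not> pair_step v v'" if "unpaired w = y # v" for y v v'
    using Cons[of "y # v'"] pair_step_Cons[of v v' y] that by auto
  show ?case
  proof
    assume "pair_step (unpaired (x # w)) w'"
    then show False
    proof cases
      case (1 u c d v)
      then show ?thesis
        using Cons tail pair_step.intros[of "tl u" c d v] pair_step.intros[of u c d v]
        by (cases u) (auto split: list.splits if_splits)
    qed
  qed
qed

lemma unpaired_append_cong: "unpaired v = unpaired v' \<Longrightarrow> unpaired (u @ v) = unpaired (u @ v')"
  by (induction u) auto

lemma unpaired_pair: "unpaired ((Plus, c) # (Minus, d) # v) = unpaired v"
  by (auto split: list.splits)

lemma unpaired_step: "pair_step w w' \<Longrightarrow> unpaired w = unpaired w'"
  by (induction rule: pair_step.induct) (metis unpaired_append_cong unpaired_pair)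

lemma unpaired_iff: "pair_step\<^sup>*\<^sup>* w w' \<and> (\<nexists>w''. pair_step w' w'') \<longleftrightarrow> w' = unpaired w"
proof
  assume *: "pair_step\<^sup>*\<^sup>* w w' \<and> (\<nexists>w''. pair_step w' w'')"
  then have "pair_step\<^sup>*\<^sup>* w w'" by simp
  then have "unpaired w = unpaired w'"
    by (induction rule: rtranclp_induct) (auto dest: unpaired_step)
  moreover have "unpaired w' = w'"
    using * unpaired_reachable[of w'] by (metis converse_rtranclpE)
  ultimately show "w' = unpaired w" by simp
qed (auto simp: unpaired_reachable unpaired_no_step)

text \<open>
  The operators take values in an option type, with \<open>None\<close> in the role of \<open>0\<close>. By column
  strictness, each number occurs in at most one cell of a column.
\<close>

definition svt_f :: "nat list \<Rightarrow> nat \<Rightarrow> filling \<Rightarrow> filling option" where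
  "svt_f lam k T =
     (let U = {j. (Minus, j) \<in> set (unpaired (signature lam k T))} in
      if U = {} then None
      else let j = Max U; i = (THE i. k \<in> T (i, j)); b = (i, j); r = (i, j + 1) in
        if k \<in> T r \<and> k + 1 \<in> T r
        then Some (T (r := T r - {k}, b := insert (k + 1) (T b)))
        else Some (T (b := insert (k + 1) (T b - {k}))))"

definition svt_e :: "nat list \<Rightarrow> nat \<Rightarrow> filling \<Rightarrow> filling option" where
  "svt_e lam k T =
     (let U = {j. (Plus, j) \<in> set (unpaired (signature lam k T))} in
      if U = {} then None
      else let j = Min U; i = (THE i. k + 1 \<in> T (i, j)); b = (i, j); l = (i, j - 1) in
        if k \<in> T l \<and> k + 1 \<in> T l
        then Some (T (l := T l - {k + 1}, b := insert k (T b)))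
        else Some (T (b := insert k (T b - {k + 1}))))"


subsection \<open>Decreasing factorizations\<close>

text \<open>
  A factorization is the list \<open>[h\<^sup>m, \<dots>, h\<^sup>1]\<close> of its factors, so that the factor with upper index
  \<open>a\<close> sits at position \<open>m - a\<close> and the product is \<open>concat h\<close>.
\<close>

definition factor :: "nat list list \<Rightarrow> nat \<Rightarrow> nat list" where
  "factor h a = h ! (length h - a)"

definition set_factor :: "nat list list \<Rightarrow> nat \<Rightarrow> nat list \<Rightarrow> nat list list" where
  "set_factor h a w = h[length h - a := w]"

definition decreasing_word :: "nat set \<Rightarrow> nat list" where
  "decreasing_word A = rev (sorted_list_of_set A)"

inductive hecke_step :: "nat list \<Rightarrow> nat list \<Rightarrow> bool" where
  commute: "p + 1 < q \<or> q + 1 < p \<Longrightarrow> hecke_step (u @ [p, q] @ v) (u @ [q, p] @ v)"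
| braid: "hecke_step (u @ [p, q, p] @ v) (u @ [q, p, q] @ v)"
| idem: "hecke_step (u @ [p, p] @ v) (u @ [p] @ v)"

definition hecke_equiv :: "nat list \<Rightarrow> nat list \<Rightarrow> bool" where
  "hecke_equiv = equivclp hecke_step"

definition hecke_reduced :: "nat list \<Rightarrow> bool" where
  "hecke_reduced w \<longleftrightarrow> (\<forall>v. hecke_equiv w v \<longrightarrow> length w \<le> length v)"

definition fully_commutative :: "nat list \<Rightarrow> bool" where
  "fully_commutative w \<longleftrightarrow>
     (\<forall>v. hecke_equiv w v \<and> hecke_reduced v \<longrightarrow>
        (\<nexists>s t i. v = s @ [i, i + 1, i] @ t \<or> v = s @ [i + 1, i, i + 1] @ t))"

definition H_star :: "nat \<Rightarrow> nat list list set" where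
  "H_star m = {h. length h = m \<and>
     (\<forall>w \<in> set h. sorted_wrt (>) w \<and> 0 \<notin> set w) \<and> fully_commutative (concat h)}"

text \<open>
  In \<open>star_pairs bs A\<close> the letters \<open>bs\<close> are treated from left to right, and \<open>A\<close> is the set of
  letters that are not yet paired. The \<open>\<star>\<close>-operators below are meant for arguments in
  \<open>H_star m\<close>; their rules make sense for any list of decreasing words.
\<close>

fun star_pairs :: "nat list \<Rightarrow> nat set \<Rightarrow> (nat \<times> nat) set" where
  "star_pairs [] A = {}"
| "star_pairs (b # bs) A =
     (let C = {a \<in> A. b \<le> a} in
      if C = {} then star_pairs bs A
      else insert (b, Min C) (star_pairs bs (A - {Min C})))"

definition star_f :: "nat \<Rightarrow> nat list list \<Rightarrow> nat list list option" where
  "star_f k h =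
     (let A = set (factor h k); B = set (factor h (k + 1));
          U = A - snd ` star_pairs (factor h (k + 1)) A in
      if U = {} then None
      else let x = Max U; z = (if x + 1 \<in> A \<inter> B then x + 1 else x) in
        Some (set_factor (set_factor h k (decreasing_word (A - {z})))
                (k + 1) (decreasing_word (insert x B))))"

definition star_e :: "nat \<Rightarrow> nat list list \<Rightarrow> nat list list option" where
  "star_e k h =
     (let A = set (factor h k); B = set (factor h (k + 1));
          U = B - fst ` star_pairs (factor h (k + 1)) A in
      if U = {} then None
      else let y = Min U; z = (if y - 1 \<in> A \<inter> B then y - 1 else y) in
        Some (set_factor (set_factor h (k + 1) (decreasing_word (B - {z})))
                k (decreasing_word (insert y A))))"


subsection \<open>Residue map\<close>

text \<open>
  Truncated subtraction is harmless here: rows of cells satisfy \<open>i \<le> length lam\<close>. Cells of a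
  set-valued tableau containing the same number have distinct contents, so the decreasing list of
  contents is determined by the set of contents.
\<close>

definition content :: "nat list \<Rightarrow> nat \<times> nat \<Rightarrow> nat" where
  "content lam c = length lam + snd c - fst c"

definition res :: "nat \<Rightarrow> nat list \<Rightarrow> filling \<Rightarrow> nat list list" where
  "res m lam T = map (\<lambda>a. decreasing_word (content lam ` {c. a \<in> T c})) (rev [1..<m + 1])"

end

theory Submission
  imports Defs
begin

text \<open>
  The \<open>\<star>\<close>-pairing is bracketing too: list the contents of all \<open>k\<close> (as \<open>-\<close>) and all \<open>k + 1\<close> (as \<open>+\<close>)
  in increasing order, with \<open>+\<close> before \<open>-\<close> at equal content. Reading the tableau column by column
  gives the same order, except that in a run of adjacent columns having \<open>k\<close> in one row and \<open>k + 1\<close>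
  in the row above, the \<open>k + 1\<close> of each column moves ahead of the \<open>k\<close> of its left neighbour. The
  contribution of such a run cancels completely in both words, so the unpaired signs agree. In a
  column with an unpaired sign, the neighbouring cell tested by the crystal operator is the only
  place where the neighbouring content can occur, so the two case distinctions agree as well.
\<close>

subsection \<open>Unpaired letters of a pair of sets\<close>

text \<open>With \<open>A\<close> and \<open>B\<close> the letters of the factors for
  \<open>k\<close> and \<open>k + 1\<close>, \<open>Plus\<close> precedes \<open>Minus\<close> at
  equal content because the star-pairing allows \<open>a = b\<close>. The variable lower end
  \<open>l\<close> permits induction from large contents to small ones.\<close>

definition content_word :: "nat \<Rightarrow> nat \<Rightarrow> nat set \<Rightarrow> nat set \<Rightarrow> (sign \<times> nat) list" where
  "content_word l h A B = concat (map (\<lambda>x. (if x \<in> B then [(Plus, x)] else []) @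
     (if x \<in> A then [(Minus, x)] else [])) [l..<h])"

lemma content_word_skip:
  assumes "l \<le> x" "x \<le> h" "\<And>z. z \<in> A \<union> B \<Longrightarrow> x \<le> z"
  shows "content_word l h A B = content_word x h A B"
proof -
  have "[l..<h] = [l..<x] @ [x..<h]"
    using assms upt_add_eq_append[of l x "h - x"] by simp
  moreover have "concat (map (\<lambda>x. (if x \<in> B then [(Plus, x)] else []) @
     (if x \<in> A then [(Minus, x)] else [])) [l..<x]) = []"
    using assms(3) by (auto simp: not_le[symmetric])
  ultimately show ?thesis by (simp add: content_word_def)
qed

lemma content_word_step:
  "l < h \<Longrightarrow> content_word l h A B = (if l \<in> B then [(Plus, l)] else []) @
     (if l \<in> A then [(Minus, l)] else []) @ content_word (Suc l) h A B"
  by (simp add: content_word_def upt_conv_Cons)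

lemma content_word_cong:
  assumes "A \<inter> {l..<h} = A' \<inter> {l..<h}" "B \<inter> {l..<h} = B' \<inter> {l..<h}"
  shows "content_word l h A B = content_word l h A' B'"
proof -
  have eq: "(x \<in> A) = (x \<in> A')" "(x \<in> B) = (x \<in> B')" if "x \<in> set [l..<h]" for x
    using assms that unfolding set_upt by blast+
  show ?thesis
    unfolding content_word_def
    by (intro arg_cong[of _ _ concat] map_cong refl) (simp only: eq)
qed

lemma content_word_insert_Minus:
  assumes "x < h" "\<And>z. z \<in> A \<union> B \<Longrightarrow> x < z"
  shows "content_word 0 h (insert x A) B = (Minus, x) # content_word 0 h A B"
proof -
  have "content_word 0 h (insert x A) B = content_word x h (insert x A) B"
    using assms by (intro content_word_skip) (auto intro: less_imp_le)
  also have "\<dots> = (Minus, x) # content_word (Suc x) h (insert x A) B"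
    using assms by (subst content_word_step) auto
  also have "content_word (Suc x) h (insert x A) B = content_word (Suc x) h A B"
    by (intro content_word_cong) auto
  also have "\<dots> = content_word 0 h A B"
    using assms by (intro content_word_skip[symmetric]) (auto intro: Suc_leI)
  finally show ?thesis .
qed

text \<open>Since \<open>Plus\<close> is written first at equal content, \<open>A\<close> may
  already contain \<open>x\<close>; so both signs of one content can be put in front, the minus
  first.\<close>

lemma content_word_insert_Plus:
  assumes "x < h" "\<And>z. z \<in> A \<Longrightarrow> x \<le> z" "\<And>z. z \<in> B \<Longrightarrow> x < z"
  shows "content_word 0 h A (insert x B) = (Plus, x) # content_word 0 h A B"
proof -
  have "content_word 0 h A (insert x B) = content_word x h A (insert x B)"
    using assms by (intro content_word_skip) (auto intro: less_imp_le)
  also have "\<dots> = (Plus, x) # (if x \<in> A then [(Minus, x)] else []) @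
      content_word (Suc x) h A (insert x B)"
    using assms by (subst content_word_step) auto
  also have "content_word (Suc x) h A (insert x B) = content_word (Suc x) h A B"
    by (intro content_word_cong) auto
  also have "(if x \<in> A then [(Minus, x)] else []) @ content_word (Suc x) h A B = content_word x h A B"
    using assms by (subst (2) content_word_step) auto
  also have "content_word x h A B = content_word 0 h A B"
    using assms by (intro content_word_skip[symmetric]) (auto intro: less_imp_le)
  finally show ?thesis .
qed

section \<open>Reduced words and the greedy pairing\<close>

definition unpaired_form :: "nat set \<Rightarrow> nat set \<Rightarrow> (sign \<times> nat) list" where
  "unpaired_form R Q =
     map (Pair Minus) (sorted_list_of_set R) @ map (Pair Plus) (sorted_list_of_set Q)"

lemma sorted_list_of_set_insert_least:
  fixes x :: nat
  assumes "finite R" "\<And>z. z \<in> R \<Longrightarrow> x < z"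
  shows "sorted_list_of_set (insert x R) = x # sorted_list_of_set R"
proof -
  have "x \<notin> R" using assms(2) by blast
  moreover have "Min (insert x R) = x"
    using assms by (intro Min_eqI) (auto intro: less_imp_le)
  ultimately show ?thesis
    using assms sorted_list_of_set_nonempty[of "insert x R"] by simp
qed

lemma unpaired_form_Minus:
  assumes "unpaired w = unpaired_form R Q" "finite R" "\<And>z. z \<in> R \<Longrightarrow> l < z"
  shows "unpaired ((Minus, l) # w) = unpaired_form (insert l R) Q"
  using assms(1) sorted_list_of_set_insert_least[OF assms(2,3)]
  by (auto simp: unpaired_form_def split: list.splits)

text \<open>In \<open>unpaired_form\<close> all minus signs come first, so a plus put in front
  cancels the first of them, which carries the least label \<open>Min R\<close>. The star-pairing
  chooses the same partner.\<close>

lemma unpaired_form_Plus: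
  assumes "unpaired w = unpaired_form R Q" "finite R" "finite Q" "\<And>z. z \<in> Q \<Longrightarrow> l < z"
  shows "unpaired ((Plus, l) # w) =
    (if R = {} then unpaired_form R (insert l Q) else unpaired_form (R - {Min R}) Q)"
proof (cases "R = {}")
  case True
  then show ?thesis
    using assms(1) sorted_list_of_set_insert_least[OF assms(3,4)]
    by (cases "sorted_list_of_set Q") (auto simp: unpaired_form_def)
next
  case False
  then show ?thesis
    using assms(1) sorted_list_of_set_nonempty[OF assms(2) False]
    by (auto simp: unpaired_form_def)
qed

text \<open>On a decreasing word \<open>star_pairs\<close> starts with the largest letter, whereas a
  content word grows at its small end. The letter treated last chooses among the elements of
  \<open>A\<close> that the earlier letters have left.\<close>

lemma star_pairs_snoc:
  "star_pairs (bs @ [b]) A = star_pairs bs A \<union>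
     (let C = {a \<in> A - snd ` star_pairs bs A. b \<le> a} in if C = {} then {} else {(b, Min C)})"
proof (induction bs arbitrary: A)
  case Nil
  then show ?case by (simp add: Let_def)
next
  case (Cons c bs)
  show ?case
  proof (cases "{a \<in> A. c \<le> a} = {}")
    case True
    then have "star_pairs (c # ds) A = star_pairs ds A" for ds by (simp add: Let_def)
    then show ?thesis by (simp only: append_Cons Cons.IH)
  next
    case False
    define M where "M = Min {a \<in> A. c \<le> a}"
    have step: "star_pairs (c # ds) A = insert (c, M) (star_pairs ds (A - {M}))" for ds
      unfolding M_def star_pairs.simps Let_def if_not_P[OF False] ..
    have "A - {M} - snd ` star_pairs bs (A - {M}) = A - snd ` star_pairs (c # bs) A"
      unfolding step by auto
    then show ?thesis by (simp only: append_Cons step Cons.IH) auto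
  qed
qed

lemma star_pairs_subset:
  assumes "finite A"
  shows "star_pairs bs A \<subseteq> {(b, a). b \<in> set bs \<and> a \<in> A \<and> b \<le> a}"
  using assms
proof (induction bs arbitrary: A)
  case Nil
  then show ?case by simp
next
  case (Cons c bs)
  have "Min {a \<in> A. c \<le> a} \<in> {a \<in> A. c \<le> a}" if "{a \<in> A. c \<le> a} \<noteq> {}"
    using Cons.prems that by (intro Min_in) auto
  then show ?case
    using Cons.IH[of A] Cons.IH[of "A - {Min {a \<in> A. c \<le> a}}"] Cons.prems
    by (auto simp: Let_def split: if_splits)
qed

text \<open>Lowering \<open>l\<close> by one puts signs in front of the word and appends at most one
  letter to the decreasing list of \<open>B\<close>-letters; the new plus cancels the least free
  minus, as in the greedy rule. Keeping all of \<open>A\<close> as candidates is harmless, since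
  letters that are at least \<open>l\<close> only choose partners that are at least
  \<open>l\<close>.\<close>

lemma unpaired_content_word_ge:
  fixes A B :: "nat set"
  assumes "A \<subseteq> {..<h}" "l \<le> h"
  defines "p \<equiv> \<lambda>l. star_pairs (rev (filter (\<lambda>x. x \<in> B) [l..<h])) A"
  shows "unpaired (content_word l h A B) =
    unpaired_form ({a \<in> A. l \<le> a} - snd ` p l) ({b \<in> B. l \<le> b \<and> b < h} - fst ` p l)"
  using assms(2)
proof (induction l rule: inc_induct)
  case base
  have "{a \<in> A. h \<le> a} - snd ` p h = {}" "{b \<in> B. h \<le> b \<and> b < h} - fst ` p h = {}"
    using assms(1) by (auto simp: not_le[symmetric])
  then show ?case by (simp only:) (simp add: content_word_def unpaired_form_def)
next
  case (step l)
  have fin: "finite A" using assms(1) finite_subset by auto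
  define R where "R = {a \<in> A. Suc l \<le> a} - snd ` p (Suc l)"
  define Q where "Q = {b \<in> B. Suc l \<le> b \<and> b < h} - fst ` p (Suc l)"
  have IH: "unpaired (content_word (Suc l) h A B) = unpaired_form R Q"
    using step.IH by (simp add: R_def Q_def)
  have finR: "finite R" and finQ: "finite Q" using fin by (auto simp: R_def Q_def)
  have R_gt: "\<And>z. z \<in> R \<Longrightarrow> l < z" and Q_gt: "\<And>z. z \<in> Q \<Longrightarrow> l < z"
    by (auto simp: R_def Q_def)
  \<comment> \<open>Pairs formed so far involve only letters above \<open>l\<close>, so
    \<open>l\<close> itself is still free on both sides.\<close>
  have p_sub: "p (Suc l) \<subseteq> {(b, a). l < b \<and> l < a}"
    using star_pairs_subset[OF fin, of "rev (filter (\<lambda>x. x \<in> B) [Suc l..<h])"]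
    unfolding p_def by fastforce
  \<comment> \<open>\<open>w\<close> is the word after a possible \<open>Minus\<close> at
    \<open>l\<close> but before a possible \<open>Plus\<close> at \<open>l\<close>; so
    \<open>R'\<close> already offers the letter \<open>l\<close> as a partner for itself.\<close>
  define w where "w = (if l \<in> A then [(Minus, l)] else []) @ content_word (Suc l) h A B"
  define R' where "R' = {a \<in> A. l \<le> a} - snd ` p (Suc l)"
  have ge: "l \<le> a \<longleftrightarrow> a = l \<or> Suc l \<le> a" for a by auto
  have R'_eq: "R' = (if l \<in> A then insert l R else R)"
    using p_sub unfolding R_def R'_def ge by auto
  have finR': "finite R'" using finR R'_eq by simp
  have w: "unpaired w = unpaired_form R' Q"
    using unpaired_form_Minus[OF IH finR R_gt] IH by (auto simp: w_def R'_eq)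
  have cw: "content_word l h A B = (if l \<in> B then [(Plus, l)] else []) @ w"
    using step.hyps by (simp add: w_def content_word_step)
  show ?case
  proof (cases "l \<in> B")
    case False
    then have "p l = p (Suc l)"
      using step.hyps by (simp add: p_def upt_conv_Cons)
    moreover have "{b \<in> B. l \<le> b \<and> b < h} = {b \<in> B. Suc l \<le> b \<and> b < h}"
      using False by (auto simp: ge)
    ultimately show ?thesis using cw False w by (simp add: R'_def Q_def)
  next
    case True
    have C: "{a \<in> A - snd ` p (Suc l). l \<le> a} = R'"
      by (auto simp: R'_def)
    have p: "p l = p (Suc l) \<union> (if R' = {} then {} else {(l, Min R')})"
    proof -
      have "p l = star_pairs (rev (filter (\<lambda>x. x \<in> B) [Suc l..<h]) @ [l]) A"
        using True step.hyps by (simp add: p_def upt_conv_Cons)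
      then show ?thesis
        unfolding star_pairs_snoc C[unfolded p_def] Let_def by (simp only: p_def)
    qed
    have B: "{b \<in> B. l \<le> b \<and> b < h} = insert l {b \<in> B. Suc l \<le> b \<and> b < h}"
      using True step.hyps by (auto simp: ge)
    have l: "l \<notin> fst ` p (Suc l)" using p_sub by auto
    have "unpaired (content_word l h A B) =
        (if R' = {} then unpaired_form R' (insert l Q) else unpaired_form (R' - {Min R'}) Q)"
      using unpaired_form_Plus[OF w finR' finQ Q_gt] cw True by simp
    moreover have "{a \<in> A. l \<le> a} - snd ` p l = (if R' = {} then R' else R' - {Min R'})"
      unfolding p by (auto simp: R'_def)
    moreover have "{b \<in> B. l \<le> b \<and> b < h} - fst ` p l = (if R' = {} then insert l Q else Q)"
      unfolding p B using l by (auto simp: Q_def)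
    ultimately show ?thesis by simp
  qed
qed

lemma set_decreasing_word: "finite A \<Longrightarrow> set (decreasing_word A) = A"
  by (simp add: decreasing_word_def)

lemma decreasing_word_filter:
  assumes "B \<subseteq> {..<h}"
  shows "decreasing_word B = rev (filter (\<lambda>x. x \<in> B) [0..<h])"
proof -
  have "set (filter (\<lambda>x. x \<in> B) [0..<h]) = B" using assms by auto
  moreover have "sorted (filter (\<lambda>x. x \<in> B) [0..<h])"
    by (simp add: sorted_filter[of id, simplified])
  ultimately have "sorted_list_of_set B = filter (\<lambda>x. x \<in> B) [0..<h]"
    using sorted_list_of_set.idem_if_sorted_distinct[of "filter (\<lambda>x. x \<in> B) [0..<h]"] by simp
  then show ?thesis by (simp add: decreasing_word_def)
qed

lemma unpaired_content_word:
  assumes "A \<subseteq> {..<h}" "B \<subseteq> {..<h}"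
  shows "A - snd ` star_pairs (decreasing_word B) A =
      {x. (Minus, x) \<in> set (unpaired (content_word 0 h A B))}"
    and "B - fst ` star_pairs (decreasing_word B) A =
      {x. (Plus, x) \<in> set (unpaired (content_word 0 h A B))}"
proof -
  have fin: "finite A" "finite B" using assms finite_subset by auto
  have "{b \<in> B. b < h} = B" using assms by auto
  then have "unpaired (content_word 0 h A B) =
      unpaired_form (A - snd ` star_pairs (decreasing_word B) A)
        (B - fst ` star_pairs (decreasing_word B) A)"
    using unpaired_content_word_ge[OF assms(1), of 0 B] decreasing_word_filter[OF assms(2)] by simp
  then show "A - snd ` star_pairs (decreasing_word B) A =
      {x. (Minus, x) \<in> set (unpaired (content_word 0 h A B))}"
    and "B - fst ` star_pairs (decreasing_word B) A =
      {x. (Plus, x) \<in> set (unpaired (content_word 0 h A B))}"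
    using fin by (auto simp: unpaired_form_def)
qed

text \<open>Cancellation inspects signs only, so labels may be changed from columns to contents
  before or after it.\<close>

lemma unpaired_map:
  assumes "\<And>x. fst (g x) = fst x"
  shows "unpaired (map g w) = map g (unpaired w)"
proof (induction w)
  case Nil
  then show ?case by simp
next
  case (Cons x w)
  then show ?case by (cases "unpaired w") (simp_all add: assms)
qed

lemma unpaired_subset: "set (unpaired w) \<subseteq> set w"
  by (induction w) (auto split: list.splits if_splits)


subsection \<open>The cells containing two consecutive numbers\<close>

text \<open>
  \<open>K\<close> and \<open>P\<close> are the sets of cells containing \<open>k\<close> and \<open>k + 1\<close> in a set-valued tableau with
  \<open>L\<close> rows and \<open>N\<close> columns.
\<close>

locale strips =
  fixes L N :: nat and K P :: "(nat \<times> nat) set"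
  assumes bounds: "(i, j) \<in> K \<union> P \<Longrightarrow> i \<le> L \<and> 1 \<le> j \<and> j \<le> N"
    and KK: "(i, j) \<in> K \<Longrightarrow> (i', j') \<in> K \<Longrightarrow> i < i' \<Longrightarrow> j' < j"
    and PP: "(i, j) \<in> P \<Longrightarrow> (i', j') \<in> P \<Longrightarrow> i < i' \<Longrightarrow> j' < j"
    and PK: "(i, j) \<in> P \<Longrightarrow> (i', j') \<in> K \<Longrightarrow> i \<le> i' \<Longrightarrow> j \<le> j' \<Longrightarrow> i = i' \<and> j = j'"
    and KP: "(i, j) \<in> K \<Longrightarrow> (i', j') \<in> P \<Longrightarrow> i < i' \<Longrightarrow> j \<le> j' \<Longrightarrow>
      i' = Suc i \<and> (i', j) \<in> P \<and> (i, j') \<in> K"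
begin

section \<open>Contents compared from column to column\<close>

definition ct :: "nat \<times> nat \<Rightarrow> nat" where
  "ct c = L + snd c - fst c"

lemma ct_less_bound: "c \<in> K \<union> P \<Longrightarrow> ct c < Suc (L + N)"
  using bounds[of "fst c" "snd c"] by (auto simp: ct_def)

definition rowK :: "nat \<Rightarrow> nat" where "rowK j = (THE i. (i, j) \<in> K)"

definition rowP :: "nat \<Rightarrow> nat" where "rowP j = (THE i. (i, j) \<in> P)"

lemma rowK_eq: "(i, j) \<in> K \<Longrightarrow> rowK j = i"
  unfolding rowK_def by (rule the_equality) (metis KK less_irrefl linorder_neqE_nat)+

lemma rowP_eq: "(i, j) \<in> P \<Longrightarrow> rowP j = i"
  unfolding rowP_def by (rule the_equality) (metis PP less_irrefl linorder_neqE_nat)+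

lemma ct_K_less:
  assumes "(i, j) \<in> K" "(i', j') \<in> K" "j < j'"
  shows "ct (i, j) < ct (i', j')"
proof -
  have "i' \<le> i" using KK[OF assms(1,2)] assms(3) by (meson less_asym not_le)
  then show ?thesis using bounds[of i j] bounds[of i' j'] assms by (auto simp: ct_def)
qed

lemma ct_P_less:
  assumes "(i, j) \<in> P" "(i', j') \<in> P" "j < j'"
  shows "ct (i, j) < ct (i', j')"
proof -
  have "i' \<le> i" using PP[OF assms(1,2)] assms(3) by (meson less_asym not_le)
  then show ?thesis using bounds[of i j] bounds[of i' j'] assms by (auto simp: ct_def)
qed

text \<open>By \<open>PK\<close> a \<open>k\<close> in a later column lies in a strictly lower row,
  so the column and the row each add at least one to the content.\<close>

lemma ct_P_less_K:
  assumes "(i, j) \<in> P" "(i', j') \<in> K" "j < j'"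
  shows "Suc (ct (i, j)) < ct (i', j')"
proof -
  have "i' < i" using PK[OF assms(1,2)] assms(3) by (metis less_imp_le less_irrefl not_le)
  then show ?thesis using bounds[of i j] bounds[of i' j'] assms by (auto simp: ct_def)
qed

text \<open>By \<open>KP\<close> a \<open>k + 1\<close> in a later column can lie in a higher row
  only if there is also one directly above the given \<open>k\<close>.\<close>

lemma ct_K_less_P:
  assumes "(i, j) \<in> K" "(i', j') \<in> P" "j < j'" "(Suc i, j) \<notin> P"
  shows "ct (i, j) < ct (i', j')"
proof -
  have "i' \<le> i" using KP[OF assms(1,2)] assms(3,4) by (metis less_imp_le not_le)
  then show ?thesis using bounds[of i j] bounds[of i' j'] assms by (auto simp: ct_def)
qed

text \<open>Each column has at most one \<open>k\<close>, and contents grow strictly with the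
  column. Injectivity turns the removal of a cell into the removal of a letter.\<close>

lemma inj_on_ct_K: "inj_on ct K"
proof (rule inj_onI)
  fix c d assume *: "c \<in> K" "d \<in> K" "ct c = ct d"
  obtain i j i' j' where cd: "c = (i, j)" "d = (i', j')" by fastforce
  with * have "j = j'" using ct_K_less by (metis less_irrefl linorder_neqE_nat)
  then show "c = d" using * cd rowK_eq by metis
qed

lemma inj_on_ct_P: "inj_on ct P"
proof (rule inj_onI)
  fix c d assume *: "c \<in> P" "d \<in> P" "ct c = ct d"
  obtain i j i' j' where cd: "c = (i, j)" "d = (i', j')" by fastforce
  with * have "j = j'" using ct_P_less by (metis less_irrefl linorder_neqE_nat)
  then show "c = d" using * cd rowP_eq by metis
qed

section \<open>Column signs against content signs\<close>

definition colK :: "nat \<Rightarrow> bool" where "colK j \<longleftrightarrow> (\<exists>i. (i, j) \<in> K)"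

definition colP :: "nat \<Rightarrow> bool" where "colP j \<longleftrightarrow> (\<exists>i. (i, j) \<in> P)"

definition sg :: "nat \<Rightarrow> (sign \<times> nat) option" where
  "sg j = (if colK j \<and> \<not> colP j then Some (Minus, j)
     else if colP j \<and> \<not> colK j then Some (Plus, j) else None)"

definition relabel :: "sign \<times> nat \<Rightarrow> sign \<times> nat" where
  "relabel x = (case x of (Minus, j) \<Rightarrow> (Minus, ct (rowK j, j)) | (Plus, j) \<Rightarrow> (Plus, ct (rowP j, j)))"

lemma fst_relabel: "fst (relabel x) = fst x"
  by (cases x; cases "fst x") (auto simp: relabel_def)

definition colsK :: "nat \<Rightarrow> nat set" where "colsK n = ct ` {c \<in> K. n \<le> snd c}"

definition colsP :: "nat \<Rightarrow> nat set" where "colsP n = ct ` {c \<in> P. n \<le> snd c}"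

abbreviation cw :: "nat set \<Rightarrow> nat set \<Rightarrow> (sign \<times> nat) list" where
  "cw \<equiv> content_word 0 (Suc (L + N))"

lemma colsK_Suc:
  "colsK n = (if colK n then insert (ct (rowK n, n)) (colsK (Suc n)) else colsK (Suc n))"
proof -
  have "{c \<in> K. n \<le> snd c} = {c \<in> K. snd c = n} \<union> {c \<in> K. Suc n \<le> snd c}" by auto
  moreover have "{c \<in> K. snd c = n} = (if colK n then {(rowK n, n)} else {})"
    by (auto simp: colK_def; metis rowK_eq)
  ultimately show ?thesis by (auto simp: colsK_def)
qed

lemma colsP_Suc:
  "colsP n = (if colP n then insert (ct (rowP n, n)) (colsP (Suc n)) else colsP (Suc n))"
proof -
  have "{c \<in> P. n \<le> snd c} = {c \<in> P. snd c = n} \<union> {c \<in> P. Suc n \<le> snd c}" by auto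
  moreover have "{c \<in> P. snd c = n} = (if colP n then {(rowP n, n)} else {})"
    by (auto simp: colP_def; metis rowP_eq)
  ultimately show ?thesis by (auto simp: colsP_def)
qed

lemma colsK_gt: "(i, n) \<in> K \<Longrightarrow> z \<in> colsK (Suc n) \<Longrightarrow> ct (i, n) < z"
  using ct_K_less by (auto simp: colsK_def)

lemma colsP_gt: "(i, n) \<in> P \<Longrightarrow> z \<in> colsP (Suc n) \<Longrightarrow> ct (i, n) < z"
  using ct_P_less by (auto simp: colsP_def)

lemma colsK_gt_P: "(i, n) \<in> P \<Longrightarrow> z \<in> colsK (Suc n) \<Longrightarrow> Suc (ct (i, n)) < z"
  using ct_P_less_K by (auto simp: colsK_def)

lemma colsP_gt_K: "(i, n) \<in> K \<Longrightarrow> (Suc i, n) \<notin> P \<Longrightarrow> z \<in> colsP (Suc n) \<Longrightarrow> ct (i, n) < z"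
  using ct_K_less_P by (auto simp: colsP_def)

text \<open>
  Columns are added from right to left. The only delicate case is a column with \<open>k\<close> at content \<open>x\<close>
  and \<open>k + 1\<close> in the cell above it, when the next column has a \<open>k + 1\<close> at content \<open>x\<close> as well: that
  letter precedes the new \<open>k\<close> in the content word and gets paired with it. By the second claim it
  was already paired before, and the new \<open>k + 1\<close> takes over its former partner.
\<close>

lemma unpaired_columns:
  assumes "n \<le> Suc N"
  shows "unpaired (cw (colsK n) (colsP n)) = map relabel (unpaired (List.map_filter sg [n..<Suc N]))
    \<and> (\<forall>i. (i, n) \<in> K \<and> (Suc i, n) \<in> P \<longrightarrow> (\<exists>w y v. cw (colsK n) (colsP n) = (Plus, ct (Suc i, n)) # w
          \<and> unpaired w = (Minus, y) # v))"
  using assms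
proof (induction n rule: inc_induct)
  case base
  have "colsK (Suc N) = {}" "colsP (Suc N) = {}"
    using bounds by (force simp: colsK_def colsP_def)+
  moreover have "(i, Suc N) \<notin> K" for i using bounds by force
  moreover have "cw {} {} = []" by (simp add: content_word_def del: upt_Suc)
  ultimately show ?case by (simp add: List.map_filter_simps)
next
  case (step n)
  let ?A = "colsK (Suc n)" and ?B = "colsP (Suc n)"
  let ?S = "List.map_filter sg [Suc n..<Suc N]"
  have S: "List.map_filter sg [n..<Suc N] = (case sg n of None \<Rightarrow> ?S | Some y \<Rightarrow> y # ?S)"
    using step.hyps by (subst upt_conv_Cons) (auto simp: List.map_filter_simps simp del: upt_Suc)
  have IH: "unpaired (cw ?A ?B) = map relabel (unpaired ?S)" using step.IH by blast
  have IHm: "unpaired (map relabel ?S) = unpaired (cw ?A ?B)"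
    by (simp add: IH unpaired_map fst_relabel)
  \<comment> \<open>The reduced form of a word depends on its tail only through the reduced tail, so
    putting one sign in front of both words preserves their agreement.\<close>
  have cons: "map relabel (unpaired (x # ?S)) = unpaired (relabel x # cw ?A ?B)" for x
    using IHm unpaired_append_cong[of "map relabel ?S" "cw ?A ?B" "[relabel x]"]
    by (simp add: unpaired_map[OF fst_relabel, symmetric] del: unpaired.simps)
  consider (none) "\<not> colK n" "\<not> colP n" | (minus) "colK n" "\<not> colP n" | (plus) "\<not> colK n" "colP n"
    | (both) "colK n" "colP n" by blast
  then show ?case
  proof cases
    case none
    then have "colsK n = ?A" "colsP n = ?B" "sg n = None" "\<And>i. (i, n) \<notin> K"
      by (simp_all add: colsK_Suc[of n] colsP_Suc[of n] sg_def) (simp add: colK_def)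
    then show ?thesis using IH S by simp
  next
    case minus
    then obtain i where i: "(i, n) \<in> K" and noP: "\<And>i. (i, n) \<notin> P" by (auto simp: colK_def colP_def)
    have "cw (colsK n) (colsP n) = (Minus, ct (i, n)) # cw ?A ?B"
      using minus i noP ct_less_bound[of "(i, n)"] colsK_gt[OF i] colsP_gt_K[OF i]
      by (auto simp: colsK_Suc[of n] colsP_Suc[of n] rowK_eq intro!: content_word_insert_Minus)
    moreover have "sg n = Some (Minus, n)" "relabel (Minus, n) = (Minus, ct (i, n))"
      using minus i by (auto simp: sg_def relabel_def rowK_eq)
    ultimately show ?thesis using S cons[of "(Minus, n)"] noP by (simp del: unpaired.simps upt_Suc)
  next
    case plus
    then obtain i where i: "(i, n) \<in> P" and noK: "\<And>i. (i, n) \<notin> K" by (auto simp: colK_def colP_def)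
    have "cw (colsK n) (colsP n) = (Plus, ct (i, n)) # cw ?A ?B"
      using plus i noK ct_less_bound[of "(i, n)"] colsK_gt_P[OF i] colsP_gt[OF i]
      by (force simp: colsK_Suc[of n] colsP_Suc[of n] rowP_eq intro!: content_word_insert_Plus)
    moreover have "sg n = Some (Plus, n)" "relabel (Plus, n) = (Plus, ct (i, n))"
      using plus i by (auto simp: sg_def relabel_def rowP_eq)
    ultimately show ?thesis using S cons[of "(Plus, n)"] noK by (simp del: unpaired.simps upt_Suc)
  next
    case both
    then obtain i i' where i: "(i, n) \<in> K" and i': "(i', n) \<in> P" by (auto simp: colK_def colP_def)
    let ?x = "ct (i, n)"
    have A: "colsK n = insert ?x ?A" using both i by (simp add: colsK_Suc[of n] rowK_eq)
    have B: "colsP n = insert (ct (i', n)) ?B" using both i' by (simp add: colsP_Suc[of n] rowP_eq)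
    have S': "List.map_filter sg [n..<Suc N] = ?S" using S both by (simp add: sg_def)
    have x: "?x < Suc (L + N)" "ct (i', n) < Suc (L + N)" using ct_less_bound i i' by auto
    have "i \<le> i'" using PK[OF i' i] by (metis linear order_refl)
    show ?thesis
    proof (cases "\<exists>z \<in> ?B. z \<le> ?x")
      \<comment> \<open>No later \<open>k + 1\<close> has content at most \<open>?x\<close>, so the
        two new signs stand side by side in front and cancel.\<close>
      case False
      have le: "ct (i', n) \<le> ?x" using \<open>i \<le> i'\<close> by (simp add: ct_def)
      have c1: "cw (colsK n) (colsP n) = (Plus, ct (i', n)) # (Minus, ?x) # cw ?A ?B"
      proof -
        have "cw (insert ?x ?A) (insert (ct (i', n)) ?B) = (Plus, ct (i', n)) # cw (insert ?x ?A) ?B"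
          using x le colsP_gt[OF i'] colsK_gt[OF i]
          by (intro content_word_insert_Plus) fastforce+
        also have "cw (insert ?x ?A) ?B = (Minus, ?x) # cw ?A ?B"
          using x False colsK_gt[OF i] by (intro content_word_insert_Minus) (auto simp: not_le)
        finally show ?thesis by (simp only: A B)
      qed
      have "unpaired (cw (colsK n) (colsP n)) = unpaired (cw ?A ?B)"
        unfolding c1 by (rule unpaired_pair)
      \<comment> \<open>A minus in front is never cancelled; it is the leading minus required by the
        second claim.\<close>
      moreover have "\<exists>v. unpaired ((Minus, ?x) # cw ?A ?B) = (Minus, ?x) # v"
        by (auto split: list.splits)
      ultimately show ?thesis
        using IH S' c1 i' rowP_eq by (metis (no_types, lifting))
    next
      case True
      then obtain i2 j2 where P2: "(i2, j2) \<in> P" "Suc n \<le> j2" and le: "ct (i2, j2) \<le> ?x"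
        by (auto simp: colsP_def)
      \<comment> \<open>A later column with no larger content forces a higher row. Then
        \<open>KP\<close> yields the row above and a \<open>k\<close> in column \<open>j2\<close>,
        and the content bound leaves only \<open>j2 = Suc n\<close>.\<close>
      have lt: "i < i2"
        using le P2 bounds[of i2 j2] bounds[of i n] i by (auto simp: ct_def)
      with KP[OF i P2(1)] P2(2) have i2: "i2 = Suc i" "(i2, n) \<in> P" "(i, j2) \<in> K" by auto
      then have i'_eq: "i' = Suc i" using i' rowP_eq by metis
      have j2: "j2 = Suc n"
        using le P2 i2 bounds[of i2 j2] by (auto simp: ct_def)
      have ctx: "ct (Suc i, Suc n) = ?x" by (simp add: ct_def)
      have cti: "Suc (ct (i', n)) = ?x"
        using i'_eq bounds[of i' n] i' by (auto simp: ct_def)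
      \<comment> \<open>The next column also has a \<open>k\<close> with \<open>k + 1\<close>
        directly above it, so the second claim of the induction hypothesis applies there; its plus
        has content \<open>?x\<close>.\<close>
      obtain w y v where w: "cw ?A ?B = (Plus, ?x) # w" "unpaired w = (Minus, y) # v"
        using step.IH i2 P2 j2 ctx by metis
      define B' where "B' = colsP (Suc (Suc n))"
      have B': "?B = insert ?x B'"
        using P2 j2 i2 ctx rowP_eq[of i2 j2] unfolding B'_def
        by (subst colsP_Suc) (auto simp: colP_def)
      have B'_gt: "\<And>z. z \<in> B' \<Longrightarrow> ?x < z"
        using colsP_gt[of "Suc i" "Suc n"] P2 j2 i2 ctx by (auto simp: B'_def)
      have "cw ?A ?B = (Plus, ?x) # cw ?A B'"
        unfolding B' using x B'_gt colsK_gt[OF i] by (intro content_word_insert_Plus) (auto intro: less_imp_le)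
      with w have w': "w = cw ?A B'" by simp
      \<comment> \<open>The new plus goes to the front, while the new minus enters between the
        former first sign and its tail \<open>w\<close>.\<close>
      have c1: "cw (colsK n) (colsP n) = (Plus, ct (i', n)) # (Plus, ?x) # (Minus, ?x) # w"
      proof -
        have "cw (insert ?x ?A) (insert (ct (i', n)) ?B) = (Plus, ct (i', n)) # cw (insert ?x ?A) ?B"
          using x cti colsP_gt[OF i'] colsK_gt[OF i]
          by (intro content_word_insert_Plus) fastforce+
        also have "cw (insert ?x ?A) ?B = (Plus, ?x) # cw (insert ?x ?A) B'"
          unfolding B' using x B'_gt colsK_gt[OF i] by (intro content_word_insert_Plus) (auto intro: less_imp_le)
        also have "cw (insert ?x ?A) B' = (Minus, ?x) # w"
          unfolding w' using x B'_gt colsK_gt[OF i] by (intro content_word_insert_Minus) auto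
        finally show ?thesis by (simp only: A B)
      qed
      have mid: "unpaired ((Plus, ?x) # (Minus, ?x) # w) = (Minus, y) # v"
        using w by (simp only: unpaired_pair)
      have "unpaired (cw (colsK n) (colsP n)) = v"
        unfolding c1 by (subst unpaired.simps(2)) (simp add: mid del: unpaired.simps)
      moreover have "unpaired (cw ?A ?B) = v" using w by simp
      ultimately show ?thesis
        using IH S' c1 mid i'_eq i rowK_eq by (metis (no_types, lifting))
    qed
  qed
qed

definition sig :: "(sign \<times> nat) list" where "sig = List.map_filter sg [1..<N + 1]"

lemma unpaired_contents:
  "{x. (Minus, x) \<in> set (unpaired (cw (ct ` K) (ct ` P)))} =
     (\<lambda>j. ct (rowK j, j)) ` {j. (Minus, j) \<in> set (unpaired sig)}"
  "{x. (Plus, x) \<in> set (unpaired (cw (ct ` K) (ct ` P)))} =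
     (\<lambda>j. ct (rowP j, j)) ` {j. (Plus, j) \<in> set (unpaired sig)}"
proof -
  have "{c \<in> K. 1 \<le> snd c} = K" "{c \<in> P. 1 \<le> snd c} = P"
    using bounds by (simp_all add: set_eq_iff) blast+
  then have "unpaired (cw (ct ` K) (ct ` P)) = map relabel (unpaired sig)"
    using unpaired_columns[of 1] by (simp add: colsK_def colsP_def sig_def)
  moreover have "(Minus, x) = relabel y \<longleftrightarrow> (\<exists>j. y = (Minus, j) \<and> x = ct (rowK j, j))"
    "(Plus, x) = relabel y \<longleftrightarrow> (\<exists>j. y = (Plus, j) \<and> x = ct (rowP j, j))" for x y
    by (cases y; cases "fst y"; auto simp: relabel_def)+
  ultimately show "{x. (Minus, x) \<in> set (unpaired (cw (ct ` K) (ct ` P)))} =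
     (\<lambda>j. ct (rowK j, j)) ` {j. (Minus, j) \<in> set (unpaired sig)}"
  "{x. (Plus, x) \<in> set (unpaired (cw (ct ` K) (ct ` P)))} =
     (\<lambda>j. ct (rowP j, j)) ` {j. (Plus, j) \<in> set (unpaired sig)}"
    by (auto simp: image_iff)
qed

lemma unpaired_Minus_column:
  assumes "(Minus, j) \<in> set (unpaired sig)"
  shows "(rowK j, j) \<in> K" "\<not> colP j"
proof -
  have "(Minus, j) \<in> set sig" using assms unpaired_subset by blast
  then have "colK j" "\<not> colP j"
    by (auto simp: sig_def List.map_filter_def sg_def split: if_splits)
  then show "(rowK j, j) \<in> K" using rowK_eq by (auto simp: colK_def)
  show "\<not> colP j" by fact
qed

lemma unpaired_Plus_column:
  assumes "(Plus, j) \<in> set (unpaired sig)"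
  shows "(rowP j, j) \<in> P" "\<not> colK j"
proof -
  have "(Plus, j) \<in> set sig" using assms unpaired_subset by blast
  then have "colP j" "\<not> colK j"
    by (auto simp: sig_def List.map_filter_def sg_def split: if_splits)
  then show "(rowP j, j) \<in> P" using rowP_eq by (auto simp: colP_def)
  show "\<not> colK j" by fact
qed

lemma finite_unpaired: "finite {j. (s, j) \<in> set (unpaired w)}"
  by (rule finite_subset[of _ "snd ` set (unpaired w)"]) force+

text \<open>Contents of the cells in \<open>K\<close> increase with the column, so the rightmost
  unpaired column and the largest unpaired letter single out the same cell.\<close>

lemma Max_contents:
  assumes "{j. (Minus, j) \<in> set (unpaired sig)} \<noteq> {}" (is "?U \<noteq> {}")
  shows "Max ((\<lambda>j. ct (rowK j, j)) ` ?U) = ct (rowK (Max ?U), Max ?U)"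
proof (rule Max_eqI)
  have M: "Max ?U \<in> ?U" using assms finite_unpaired Max_in by blast
  then show "ct (rowK (Max ?U), Max ?U) \<in> (\<lambda>j. ct (rowK j, j)) ` ?U" by blast
  fix y assume "y \<in> (\<lambda>j. ct (rowK j, j)) ` ?U"
  then obtain j where j: "j \<in> ?U" "y = ct (rowK j, j)" by blast
  then have "j \<le> Max ?U" using finite_unpaired by simp
  then show "y \<le> ct (rowK (Max ?U), Max ?U)"
    using j M ct_K_less[of "rowK j" j "rowK (Max ?U)" "Max ?U"]
      unpaired_Minus_column(1)[of j] unpaired_Minus_column(1)[of "Max ?U"]
    by (cases "j = Max ?U") auto
qed (use finite_unpaired in blast)

lemma Min_contents:
  assumes "{j. (Plus, j) \<in> set (unpaired sig)} \<noteq> {}" (is "?U \<noteq> {}")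
  shows "Min ((\<lambda>j. ct (rowP j, j)) ` ?U) = ct (rowP (Min ?U), Min ?U)"
proof (rule Min_eqI)
  have M: "Min ?U \<in> ?U" using assms finite_unpaired Min_in by blast
  then show "ct (rowP (Min ?U), Min ?U) \<in> (\<lambda>j. ct (rowP j, j)) ` ?U" by blast
  fix y assume "y \<in> (\<lambda>j. ct (rowP j, j)) ` ?U"
  then obtain j where j: "j \<in> ?U" "y = ct (rowP j, j)" by blast
  then have "Min ?U \<le> j" using finite_unpaired by simp
  then show "ct (rowP (Min ?U), Min ?U) \<le> y"
    using j M ct_P_less[of "rowP (Min ?U)" "Min ?U" "rowP j" j]
      unpaired_Plus_column(1)[of j] unpaired_Plus_column(1)[of "Min ?U"]
    by (cases "j = Min ?U") auto
qed (use finite_unpaired in blast)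

section \<open>Neighbouring cells and neighbouring contents\<close>

lemma right_neighbour_K:
  assumes "(i, j) \<in> K"
  shows "ct (i, j) + 1 \<in> ct ` K \<longleftrightarrow> (i, j + 1) \<in> K"
proof
  assume "ct (i, j) + 1 \<in> ct ` K"
  then obtain i' j' where *: "(i', j') \<in> K" "ct (i', j') = ct (i, j) + 1" by auto
  then have "j < j'"
    using ct_K_less[of i' j' i j] assms rowK_eq by (metis add_lessD1 less_add_one less_irrefl linorder_neqE_nat)
  then have "i' \<le> i" using KK[OF assms *(1)] by (meson less_asym not_le)
  then have "i' = i \<and> j' = j + 1"
    using * \<open>j < j'\<close> bounds[of i j] bounds[of i' j'] assms by (auto simp: ct_def)
  then show "(i, j + 1) \<in> K" using * by simp
next
  assume "(i, j + 1) \<in> K"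
  moreover have "ct (i, j + 1) = ct (i, j) + 1"
    using bounds[of i j] assms by (auto simp: ct_def)
  ultimately show "ct (i, j) + 1 \<in> ct ` K" by (metis imageI)
qed

text \<open>A run of columns could put a \<open>k + 1\<close> of this content at
  \<open>(i + 1, j + 2)\<close>. The hypothesis on column \<open>j\<close> excludes this, since
  \<open>KP\<close> would give a \<open>k + 1\<close> in column \<open>j\<close> itself.\<close>

lemma right_neighbour_P:
  assumes "(i, j) \<in> K" "\<not> colP j"
  shows "ct (i, j) + 1 \<in> ct ` P \<longleftrightarrow> (i, j + 1) \<in> P"
proof
  assume "ct (i, j) + 1 \<in> ct ` P"
  then obtain i' j' where *: "(i', j') \<in> P" "ct (i', j') = ct (i, j) + 1" by auto
  have "j' \<noteq> j" using * assms(2) by (auto simp: colP_def)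
  then have "j < j'"
    using ct_P_less_K[of i' j' i j] assms * by (metis Suc_eq_plus1 Suc_lessD less_add_one less_asym linorder_neqE_nat)
  then have "i' \<le> i" using KP[OF assms(1) *(1)] assms(2) unfolding colP_def by (metis less_imp_le not_le)
  then have "i' = i \<and> j' = j + 1"
    using * \<open>j < j'\<close> bounds[of i j] bounds[of i' j'] assms by (auto simp: ct_def)
  then show "(i, j + 1) \<in> P" using * by simp
next
  assume "(i, j + 1) \<in> P"
  moreover have "ct (i, j + 1) = ct (i, j) + 1"
    using bounds[of i j] assms by (auto simp: ct_def)
  ultimately show "ct (i, j) + 1 \<in> ct ` P" by (metis imageI)
qed

lemma ct_left: "(i, j) \<in> K \<union> P \<Longrightarrow> ct (i, j - 1) = ct (i, j) - 1"
  using bounds[of i j] by (auto simp: ct_def)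

lemma left_neighbour_P:
  assumes "(i, j) \<in> P"
  shows "ct (i, j) - 1 \<in> ct ` P \<longleftrightarrow> (i, j - 1) \<in> P"
proof
  assume "ct (i, j) - 1 \<in> ct ` P"
  then obtain i' j' where *: "(i', j') \<in> P" "ct (i', j') = ct (i, j) - 1" by auto
  \<comment> \<open>Positivity makes the truncated \<open>ct (i, j) - 1\<close> a true
    predecessor.\<close>
  have pos: "1 \<le> ct (i, j)" using bounds[of i j] assms by (auto simp: ct_def)
  have "j' < j"
    using ct_P_less[of i j i' j'] assms * pos rowP_eq
    by (metis One_nat_def diff_less less_asym less_irrefl linorder_neqE_nat zero_less_one Suc_le_lessD)
  then have "i \<le> i'" using PP[OF *(1) assms] by (meson less_asym not_le)
  then have "i' = i \<and> j' = j - 1"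
    using * \<open>j' < j\<close> bounds[of i j] bounds[of i' j'] assms by (auto simp: ct_def)
  then show "(i, j - 1) \<in> P" using * by simp
next
  assume "(i, j - 1) \<in> P"
  then show "ct (i, j) - 1 \<in> ct ` P" using ct_left assms by (metis UnI2 imageI)
qed

text \<open>Mirror image of \<open>right_neighbour_P\<close>: by \<open>KP\<close> a
  \<open>k\<close> in an earlier column and a lower row would force a \<open>k\<close> in column
  \<open>j\<close>.\<close>

lemma left_neighbour_K:
  assumes "(i, j) \<in> P" "\<not> colK j"
  shows "ct (i, j) - 1 \<in> ct ` K \<longleftrightarrow> (i, j - 1) \<in> K"
proof
  assume "ct (i, j) - 1 \<in> ct ` K"
  then obtain i' j' where *: "(i', j') \<in> K" "ct (i', j') = ct (i, j) - 1" by auto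
  have "j' \<noteq> j" using * assms(2) by (auto simp: colK_def)
  then have "j' < j"
    using ct_P_less_K[of i j i' j'] assms * by (metis diff_le_self Suc_lessD not_le linorder_neqE_nat)
  then have "i \<le> i'" using KP[OF *(1) assms(1)] assms(2) unfolding colK_def by (metis less_imp_le not_le)
  then have "i' = i \<and> j' = j - 1"
    using * \<open>j' < j\<close> bounds[of i j] bounds[of i' j'] assms by (auto simp: ct_def)
  then show "(i, j - 1) \<in> K" using * by simp
next
  assume "(i, j - 1) \<in> K"
  then show "ct (i, j) - 1 \<in> ct ` K" using ct_left assms by (metis UnI2 imageI)
qed

end

subsection \<open>Set-valued tableaux\<close>

lemma part_antimono:
  assumes "is_partition lam" "1 \<le> i" "i \<le> i'"
  shows "part lam i' \<le> part lam i"
proof (cases "i = i' \<or> length lam < i'")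
  case True
  then show ?thesis by (auto simp: part_def)
next
  case False
  then show ?thesis
    using assms sorted_wrt_nth_less[of "(\<ge>)" lam "i - 1" "i' - 1"]
    by (auto simp: part_def is_partition_def)
qed

text \<open>Row lengths weakly decrease upwards, so the upper cell gives the bound from
  \<open>lam\<close> and the lower cell the bound from \<open>mu\<close>. This supplies the nonempty
  intermediate cells for the comparisons below.\<close>

lemma skew_cells_rectangle:
  assumes "is_partition lam" "is_partition mu"
    and "(i, j) \<in> skew_cells lam mu" "(i', j') \<in> skew_cells lam mu"
    and "i \<le> r" "r \<le> i'" "j \<le> s" "s \<le> j'"
  shows "(r, s) \<in> skew_cells lam mu"
  using assms part_antimono[OF assms(1), of r i'] part_antimono[OF assms(2), of i r]
  by (auto simp: skew_cells_def)

lemma SVT_cell: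
  assumes "T \<in> SVT m lam mu" "a \<in> T c"
  shows "c \<in> skew_cells lam mu"
proof (rule ccontr)
  assume "c \<notin> skew_cells lam mu"
  then have "T c = {}" using assms(1) unfolding SVT_def by blast
  with assms(2) show False by simp
qed

lemma SVT_finite:
  assumes "T \<in> SVT m lam mu"
  shows "finite (T c)"
proof (cases "T c = {}")
  case False
  then have "c \<in> skew_cells lam mu" using SVT_cell[OF assms] by blast
  then have "T c \<subseteq> {1..m}" using assms unfolding SVT_def by blast
  then show ?thesis by (rule finite_subset) simp
qed simp

lemma SVT_adjacent:
  assumes T: "T \<in> SVT m lam mu" and a: "a \<in> T (i, j)"
  shows "b \<in> T (i, Suc j) \<Longrightarrow> a \<le> b" and "b \<in> T (Suc i, j) \<Longrightarrow> a < b"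
proof -
  note fin = SVT_finite[OF T]
  have c: "(i, j) \<in> skew_cells lam mu" using SVT_cell[OF T a] .
  show "a \<le> b" if b: "b \<in> T (i, Suc j)"
  proof -
    have "Max (T (i, j)) \<le> Min (T (i, Suc j))"
      using T c SVT_cell[OF T b] by (simp add: SVT_def)
    then show ?thesis using Max_ge[OF fin a] Min_le[OF fin b] by linarith
  qed
  show "a < b" if b: "b \<in> T (Suc i, j)"
  proof -
    have "Max (T (i, j)) < Min (T (Suc i, j))"
      using T c SVT_cell[OF T b] by (simp add: SVT_def)
    then show ?thesis using Max_ge[OF fin a] Min_le[OF fin b] by linarith
  qed
qed

text \<open>The comparison is chained through the cells in between. The offset
  \<open>Suc (j + d)\<close> keeps the two cells distinct, as entries of a single cell need not be
  ordered this way.\<close>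

lemma SVT_row_le:
  assumes "is_partition lam" "is_partition mu" and T: "T \<in> SVT m lam mu"
    and a: "a \<in> T (i, j)" and "b \<in> T (i, Suc (j + d))"
  shows "a \<le> b"
  using assms(5)
proof (induction d arbitrary: b)
  case 0
  then show ?case using SVT_adjacent(1)[OF T a] by simp
next
  case (Suc d)
  have "(i, Suc (j + d)) \<in> skew_cells lam mu"
    using skew_cells_rectangle[OF assms(1,2) SVT_cell[OF T a] SVT_cell[OF T Suc.prems]] by simp
  then obtain c where c: "c \<in> T (i, Suc (j + d))" using T by (fastforce simp: SVT_def)
  then show ?case using Suc.IH[OF c] SVT_adjacent(1)[OF T c] Suc.prems by fastforce
qed

lemma SVT_column_less:
  assumes "is_partition lam" "is_partition mu" and T: "T \<in> SVT m lam mu"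
    and a: "a \<in> T (i, j)" and "b \<in> T (Suc (i + d), j)"
  shows "a < b"
  using assms(5)
proof (induction d arbitrary: b)
  case 0
  then show ?case using SVT_adjacent(2)[OF T a] by simp
next
  case (Suc d)
  have "(Suc (i + d), j) \<in> skew_cells lam mu"
    using skew_cells_rectangle[OF assms(1,2) SVT_cell[OF T a] SVT_cell[OF T Suc.prems]] by simp
  then obtain c where c: "c \<in> T (Suc (i + d), j)" using T by (fastforce simp: SVT_def)
  then show ?case using Suc.IH[OF c] SVT_adjacent(2)[OF T c] Suc.prems by fastforce
qed

text \<open>The path goes right along row \<open>i\<close> and then up column \<open>j'\<close>; its
  corner \<open>(i, j')\<close> belongs to the shape.\<close>

lemma SVT_less:
  assumes "is_partition lam" "is_partition mu" and T: "T \<in> SVT m lam mu"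
    and a: "a \<in> T (i, j)" and b: "b \<in> T (i', j')" and "i < i'" "j \<le> j'"
  shows "a < b"
proof (cases "j = j'")
  case True
  then show ?thesis
    using SVT_column_less[OF assms(1-4), of b "i' - Suc i"] b \<open>i < i'\<close> by simp
next
  case False
  have "(i, j') \<in> skew_cells lam mu"
    using skew_cells_rectangle[OF assms(1,2) SVT_cell[OF T a] SVT_cell[OF T b]] assms(6,7) by simp
  then obtain c where c: "c \<in> T (i, j')" using T by (fastforce simp: SVT_def)
  then show ?thesis
    using SVT_row_le[OF assms(1-4), of c "j' - Suc j"] False assms(6,7) b
      SVT_column_less[OF assms(1-3) c, of b "i' - Suc i"] by simp
qed

text \<open>\<open>KK\<close>, \<open>PP\<close> and \<open>PK\<close> hold because entries increase
  weakly to the right and strictly upwards. For \<open>KP\<close>, the rectangle spanned by the two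
  cells is squeezed between \<open>k\<close> and \<open>k + 1\<close>.\<close>

lemma strips_SVT:
  assumes part: "is_partition lam" "is_partition mu" and T: "T \<in> SVT m lam mu"
  shows "strips (length lam) (part lam 1) {c. k \<in> T c} {c. k + 1 \<in> T c}"
proof
  note less = SVT_less[OF assms]
  fix i j i' j'
  show "i \<le> length lam \<and> 1 \<le> j \<and> j \<le> part lam 1" if "(i, j) \<in> {c. k \<in> T c} \<union> {c. k + 1 \<in> T c}"
  proof -
    have "(i, j) \<in> skew_cells lam mu" using that SVT_cell[OF T] by blast
    then have *: "1 \<le> i" "part mu i < j" "j \<le> part lam i" by (auto simp: skew_cells_def)
    then have "i \<le> length lam" by (auto simp: part_def split: if_splits)
    then show ?thesis using * part_antimono[OF part(1), of 1 i] by auto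
  qed
  show "j' < j" if "(i, j) \<in> {c. k \<in> T c}" "(i', j') \<in> {c. k \<in> T c}" "i < i'"
    using less[of k i j k i' j'] that by (auto simp: not_le[symmetric])
  show "j' < j" if "(i, j) \<in> {c. k + 1 \<in> T c}" "(i', j') \<in> {c. k + 1 \<in> T c}" "i < i'"
    using less[of "k + 1" i j "k + 1" i' j'] that by (auto simp: not_le[symmetric])
  show "i = i' \<and> j = j'" if "(i, j) \<in> {c. k + 1 \<in> T c}" "(i', j') \<in> {c. k \<in> T c}" "i \<le> i'" "j \<le> j'"
  proof (rule ccontr)
    assume ne: "\<not> (i = i' \<and> j = j')"
    show False
    proof (cases "i = i'")
      case True
      then show ?thesis
        using SVT_row_le[OF assms, of "k + 1" i j k "j' - Suc j"] that ne by simp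
    next
      case False
      then show ?thesis using less[of "k + 1" i j k i' j'] that by simp
    qed
  qed
  show "i' = Suc i \<and> (i', j) \<in> {c. k + 1 \<in> T c} \<and> (i, j') \<in> {c. k \<in> T c}"
    if "(i, j) \<in> {c. k \<in> T c}" "(i', j') \<in> {c. k + 1 \<in> T c}" "i < i'" "j \<le> j'"
  proof -
    have k: "k \<in> T (i, j)" and k1: "k + 1 \<in> T (i', j')" using that by auto
    have ex: "\<exists>c. c \<in> T (r, s)" if "i \<le> r" "r \<le> i'" "j \<le> s" "s \<le> j'" for r s
      using skew_cells_rectangle[OF part SVT_cell[OF T k] SVT_cell[OF T k1] that] T
      by (fastforce simp: SVT_def)
    \<comment> \<open>With a further row in between, \<open>x\<close> would lie strictly between
      \<open>k\<close> and \<open>k + 1\<close>. For \<open>j \<noteq> j'\<close> the corner entries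
      \<open>y\<close> and \<open>z\<close> are forced to be \<open>k + 1\<close> and
      \<open>k\<close>.\<close>
    obtain x y z where x: "x \<in> T (Suc i, j)" and y: "y \<in> T (i', j)" and z: "z \<in> T (i, j')"
      using ex[of "Suc i" j] ex[of i' j] ex[of i j'] \<open>i < i'\<close> \<open>j \<le> j'\<close> by auto
    have "i' = Suc i"
      using less[OF k x] less[OF x k1] \<open>i < i'\<close> \<open>j \<le> j'\<close> by fastforce
    moreover have "k + 1 \<in> T (i', j)"
    proof (cases "j = j'")
      case False
      then have "y \<le> k + 1"
        using SVT_row_le[OF assms y, of "k + 1" "j' - Suc j"] k1 \<open>j \<le> j'\<close> by simp
      then show ?thesis using less[OF k y] y \<open>i < i'\<close> by (metis Suc_eq_plus1 Suc_leI le_antisym order_refl)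
    qed (use k1 in simp)
    moreover have "k \<in> T (i, j')"
    proof (cases "j = j'")
      case False
      then have "k \<le> z"
        using SVT_row_le[OF assms k, of z "j' - Suc j"] z \<open>j \<le> j'\<close> by simp
      then show ?thesis using less[OF z k1] z \<open>i < i'\<close> by (metis Suc_eq_plus1 less_Suc_eq_le le_antisym order_refl)
    qed (use k in simp)
    ultimately show ?thesis by simp
  qed
qed

section \<open>Residues of a tableau changed in two numbers\<close>

lemma factor_res:
  assumes "1 \<le> a" "a \<le> m"
  shows "factor (res m lam T) a = decreasing_word (content lam ` {c. a \<in> T c})"
  using assms by (auto simp: factor_def res_def rev_nth simp del: upt_Suc)

lemma res_update:
  assumes "1 \<le> k" "k < m" and "\<And>a c. a \<noteq> k \<Longrightarrow> a \<noteq> k + 1 \<Longrightarrow> a \<in> T' c \<longleftrightarrow> a \<in> T c"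
  shows "res m lam T' = set_factor (set_factor (res m lam T) k
      (decreasing_word (content lam ` {c. k \<in> T' c})))
      (k + 1) (decreasing_word (content lam ` {c. k + 1 \<in> T' c}))"
proof (rule nth_equalityI)
  fix p assume "p < length (res m lam T')"
  then have p: "p < m" by (simp add: res_def del: upt_Suc)
  have nth: "res m lam S ! p = decreasing_word (content lam ` {c. m - p \<in> S c})" for S
    using factor_res[of "m - p" m lam S] p by (simp add: factor_def res_def)
  have eq: "{c. m - p \<in> T' c} = {c. m - p \<in> T c}" if "m - p \<noteq> k" "m - p \<noteq> k + 1"
    using assms(3)[OF that] by blast
  \<comment> \<open>Position \<open>p\<close> holds the factor of index
    \<open>m - p\<close>.\<close>
  have "m - p = k \<longleftrightarrow> m - k = p" "m - p = k + 1 \<longleftrightarrow> m - (k + 1) = p" using p assms by auto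
  moreover have "length (res m lam T) = m" by (simp add: res_def)
  ultimately show "res m lam T' ! p = set_factor (set_factor (res m lam T) k
      (decreasing_word (content lam ` {c. k \<in> T' c})))
      (k + 1) (decreasing_word (content lam ` {c. k + 1 \<in> T' c})) ! p"
    using p eq by (auto simp: set_factor_def nth_list_update nth)
qed (simp add: res_def set_factor_def)


text \<open>\<open>star_e\<close> writes the factor \<open>k + 1\<close> first, whereas
  \<open>res_update\<close> writes the factor \<open>k\<close> first.\<close>

lemma set_factor_swap:
  assumes "1 \<le> k" "k < length h"
  shows "set_factor (set_factor h (k + 1) v) k w = set_factor (set_factor h k w) (k + 1) v"
proof -
  have "length h - k \<noteq> length h - (k + 1)" using assms by simp
  then show ?thesis unfolding set_factor_def length_list_update by (rule list_update_swap[symmetric])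
qed

section \<open>Comparison of the two crystals\<close>

theorem theorem2p17:
  fixes m k :: nat and lam mu :: "nat list" and T :: filling
  assumes "m \<ge> 2"
    and "is_partition lam" and "is_partition mu" and "partition_le mu lam"
    and "1 \<le> k" and "k < m"
    and "T \<in> SVT m lam mu"
  shows "map_option (res m lam) (svt_f lam k T) = star_f k (res m lam T)
    \<and> map_option (res m lam) (svt_e lam k T) = star_e k (res m lam T)
    \<and> (svt_f lam k T = None \<longleftrightarrow> star_f k (res m lam T) = None)
    \<and> (svt_e lam k T = None \<longleftrightarrow> star_e k (res m lam T) = None)"
proof -
  define K P where "K = {c. k \<in> T c}" and "P = {c. k + 1 \<in> T c}"
  interpret strips "length lam" "part lam 1" K P
    unfolding K_def P_def using assms strips_SVT by blast
  define A B h where "A = ct ` K" and "B = ct ` P" and "h = res m lam T"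
  have content: "content lam = ct"
    by (simp add: fun_eq_iff ct_def content_def)
  have "column_sign T k = sg"
    unfolding fun_eq_iff column_sign_def sg_def in_column_def colK_def colP_def
    by (simp add: K_def P_def cong: if_cong)
  then have sig: "signature lam k T = sig"
    unfolding signature_def sig_def by (simp only:)
  have AB: "A \<subseteq> {..<Suc (length lam + part lam 1)}" "B \<subseteq> {..<Suc (length lam + part lam 1)}"
    using ct_less_bound by (auto simp: A_def B_def)
  then have fin: "finite A" "finite B" using finite_subset by blast+
  have factors: "factor h k = decreasing_word A" "factor h (k + 1) = decreasing_word B"
    unfolding h_def A_def B_def K_def P_def
    using factor_res[of k m lam T] factor_res[of "k + 1" m lam T] assms(5,6)
    by (simp_all add: content)
  have sets: "set (factor h k) = A" "set (factor h (k + 1)) = B"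
    unfolding factors using fin by (simp_all add: set_decreasing_word)
  define U where "U = {j. (Minus, j) \<in> set (unpaired sig)}"
  define V where "V = {j. (Plus, j) \<in> set (unpaired sig)}"
  \<comment> \<open>Both kinds of operators are now governed by the same column sets
    \<open>U\<close> and \<open>V\<close>, so they vanish together.\<close>
  have UA: "A - snd ` star_pairs (factor h (k + 1)) A = (\<lambda>j. ct (rowK j, j)) ` U"
    and VB: "B - fst ` star_pairs (factor h (k + 1)) A = (\<lambda>j. ct (rowP j, j)) ` V"
    unfolding factors using unpaired_content_word[OF AB] unpaired_contents
    by (simp_all only: A_def B_def U_def V_def)
  have the: "(THE i. k \<in> T (i, j)) = rowK j" "(THE i. k + 1 \<in> T (i, j)) = rowP j" for j
    unfolding rowK_def rowP_def by (simp_all add: K_def P_def)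
  have update: "res m lam T' = set_factor (set_factor h k (decreasing_word (ct ` {c. k \<in> T' c})))
      (k + 1) (decreasing_word (ct ` {c. k + 1 \<in> T' c}))"
    if "\<And>a c. a \<noteq> k \<Longrightarrow> a \<noteq> k + 1 \<Longrightarrow> a \<in> T' c \<longleftrightarrow> a \<in> T c" for T'
    using res_update[OF assms(5,6) that] by (simp add: content h_def)
  have f: "map_option (res m lam) (svt_f lam k T) = star_f k h"
  proof (cases "U = {}")
    case True
    then show ?thesis
      unfolding svt_f_def star_f_def sig U_def[symmetric] Let_def sets UA by simp
  next
    case False
    define j where "j = Max U"
    define i where "i = rowK j"
    define x where "x = ct (i, j)"
    have "j \<in> U" using False finite_unpaired Max_in unfolding j_def U_def by blast
    then have ij: "(i, j) \<in> K" "\<not> colP j"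
      using unpaired_Minus_column by (auto simp: U_def i_def)
    have Max: "Max ((\<lambda>j. ct (rowK j, j)) ` U) = x"
      using Max_contents False unfolding U_def x_def i_def j_def by blast
    \<comment> \<open>A letter \<open>x + 1\<close> in either factor can only come from the cell on
      the right, so the tableau test and the star test coincide.\<close>
    have cond: "k \<in> T (i, j + 1) \<and> k + 1 \<in> T (i, j + 1) \<longleftrightarrow> x + 1 \<in> A \<inter> B"
      using right_neighbour_K[OF ij(1)] right_neighbour_P[OF ij]
      by (simp add: x_def A_def B_def K_def P_def)
    define T' where "T' = (if x + 1 \<in> A \<inter> B
      then T ((i, j + 1) := T (i, j + 1) - {k}, (i, j) := insert (k + 1) (T (i, j)))
      else T ((i, j) := insert (k + 1) (T (i, j) - {k})))"
    \<comment> \<open>\<open>d\<close> is the cell that loses its \<open>k\<close>; in both cases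
      \<open>(i, j)\<close> gains the \<open>k + 1\<close>, so \<open>x\<close> enters the other
      factor.\<close>
    define d where "d = (if x + 1 \<in> A \<inter> B then (i, j + 1) else (i, j))"
    have dK: "d \<in> K" using cond ij by (auto simp: d_def K_def)
    have ctd: "ct d = (if x + 1 \<in> A \<inter> B then x + 1 else x)"
      using bounds[of i j] ij by (auto simp: d_def x_def ct_def)
    have "{c. k \<in> T' c} = K - {d}" "{c. k + 1 \<in> T' c} = insert (i, j) P"
      using ij(1) by (auto simp: T'_def d_def K_def P_def split: if_splits)
    moreover have "ct ` (K - {d}) = A - {ct d}"
      using inj_on_image_set_diff[OF inj_on_ct_K, of K "{d}"] dK by (simp add: A_def)
    moreover have "ct ` insert (i, j) P = insert x B" by (simp add: x_def B_def)
    moreover have "a \<in> T' c \<longleftrightarrow> a \<in> T c" if "a \<noteq> k" "a \<noteq> k + 1" for a c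
      using that by (auto simp: T'_def)
    ultimately have "res m lam T' = set_factor (set_factor h k (decreasing_word (A - {ct d})))
        (k + 1) (decreasing_word (insert x B))"
      using update[of T'] by simp
    moreover have "svt_f lam k T = Some T'"
      using False cond unfolding svt_f_def sig U_def[symmetric] Let_def j_def[symmetric] the
        i_def[symmetric] T'_def by auto
    moreover have "star_f k h = Some (set_factor (set_factor h k (decreasing_word (A - {ct d})))
        (k + 1) (decreasing_word (insert x B)))"
      using False unfolding star_f_def sets UA Let_def Max ctd by simp
    ultimately show ?thesis by simp
  qed
  have e: "map_option (res m lam) (svt_e lam k T) = star_e k h"
  proof (cases "V = {}")
    case True
    then show ?thesis
      unfolding svt_e_def star_e_def sig V_def[symmetric] Let_def sets VB by simp
  next
    case False
    define j where "j = Min V"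
    define i where "i = rowP j"
    define y where "y = ct (i, j)"
    have "j \<in> V" using False finite_unpaired Min_in unfolding j_def V_def by blast
    then have ij: "(i, j) \<in> P" "\<not> colK j"
      using unpaired_Plus_column by (auto simp: V_def i_def)
    \<comment> \<open>With columns starting at 1, \<open>j - 1\<close> is a true predecessor and the
      two updated cells differ.\<close>
    have j: "1 \<le> j" using bounds[of i j] ij by auto
    have Min: "Min ((\<lambda>j. ct (rowP j, j)) ` V) = y"
      using Min_contents False unfolding V_def y_def i_def j_def by blast
    have cond: "k \<in> T (i, j - 1) \<and> k + 1 \<in> T (i, j - 1) \<longleftrightarrow> y - 1 \<in> A \<inter> B"
      using left_neighbour_K[OF ij] left_neighbour_P[OF ij(1)]
      by (simp add: y_def A_def B_def K_def P_def)
    define T' where "T' = (if y - 1 \<in> A \<inter> B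
      then T ((i, j - 1) := T (i, j - 1) - {k + 1}, (i, j) := insert k (T (i, j)))
      else T ((i, j) := insert k (T (i, j) - {k + 1})))"
    define d where "d = (if y - 1 \<in> A \<inter> B then (i, j - 1) else (i, j))"
    have dP: "d \<in> P" using cond ij by (auto simp: d_def P_def)
    have ctd: "ct d = (if y - 1 \<in> A \<inter> B then y - 1 else y)"
      using ct_left ij by (auto simp: d_def y_def)
    have "{c. k + 1 \<in> T' c} = P - {d}" "{c. k \<in> T' c} = insert (i, j) K"
      using ij(1) j by (auto simp: T'_def d_def K_def P_def split: if_splits)
    moreover have "ct ` (P - {d}) = B - {ct d}"
      using inj_on_image_set_diff[OF inj_on_ct_P, of P "{d}"] dP by (simp add: B_def)
    moreover have "ct ` insert (i, j) K = insert y A" by (simp add: y_def A_def)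
    moreover have "a \<in> T' c \<longleftrightarrow> a \<in> T c" if "a \<noteq> k" "a \<noteq> k + 1" for a c
      using that by (auto simp: T'_def)
    ultimately have "res m lam T' = set_factor (set_factor h k (decreasing_word (insert y A)))
        (k + 1) (decreasing_word (B - {ct d}))"
      using update[of T'] by simp
    also have "\<dots> = set_factor (set_factor h (k + 1) (decreasing_word (B - {ct d})))
        k (decreasing_word (insert y A))"
      using assms(5,6) by (intro set_factor_swap[symmetric]) (simp_all add: h_def res_def del: upt_Suc)
    finally have "res m lam T' = \<dots>" .
    moreover have "svt_e lam k T = Some T'"
      using False cond unfolding svt_e_def sig V_def[symmetric] Let_def j_def[symmetric] the
        i_def[symmetric] T'_def by auto
    moreover have "star_e k h = Some (set_factor (set_factor h (k + 1) (decreasing_word (B - {ct d})))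
        k (decreasing_word (insert y A)))"
      using False unfolding star_e_def sets VB Let_def Min ctd by simp
    ultimately show ?thesis by simp
  qed
  show ?thesis
    unfolding h_def[symmetric] f[symmetric] e[symmetric] by simp
qed

end
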